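(* Let $K\subset\mathbb{C}$ be an arbitrary non-empty compact set, let $(\Omega,\mathcal A)$ be a measurable space, and let $f:\Omega\times K\to\mathbb{C}$ be a random function on $K$. Suppose that, for each $\omega\in\Omega$, there exist an open neighborhood $U_\omega$ of $K$ and a function $g_\omega$ holomorphic on $U_\omega$ such that $g_\omega|_K=f(\omega,\cdot)$. Then $f\in R_\Omega^{\mathrm{unif}}(K)$; that is, for every $\varepsilon>0$ there exists a random rational function $r$ pole-free on $K$ such that $|r(\omega,z)-f(\omega,z)|<\varepsilon$ for all $(\omega,z)\in\Omega\times K$.
   Context: Measurability of complex-valued functions is with respect to the Borel $\sigma$-algebra on $\mathbb{C}$. A function $f:\Omega\times K\to\mathbb{C}$ is a random function on $K$ if $f(\cdot,z)$ is measurable on $(\Omega,\mathcal A)$ for each $z\in K$. A random rational function pole-free on $K$ is a random function $r:\Omega\times K\to\mathbb{C}$ such that, for each $\omega\in\Omega$, $r(\omega,\cdot)$ is (the restriction to $K$ of) a rational function with no poles on $K$. The class $R_\Omega^{\mathrm{unif}}(K)$ consists of those random functions $f$ on $K$, with each $f(\omega,\cdot)$ continuous on $K$ and holomorphic on the interior of $K$, such that for every $\varepsilon>0$ there is a random rational function $r$ pole-free on $K$ with $|r(\omega,z)-f(\omega,z)|<\varepsilon$ for all $(\omega,z)\in\Omega\times K$. *)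

theory Defs
  imports "HOL-Analysis.Analysis" "HOL-Computational_Algebra.Polynomial"
begin

text \<open>
  The measurable space is given by \<open>space M\<close> and \<open>sets M\<close>; the measure carried by \<open>M\<close> is
  not used. A function on the product of \<open>space M\<close> and \<open>K\<close> is a curried total
  function whose values elsewhere are never constrained or used.
\<close>

definition random_function :: "'w measure \<Rightarrow> complex set \<Rightarrow> ('w \<Rightarrow> complex \<Rightarrow> complex) \<Rightarrow> bool" where
  "random_function M K f \<longleftrightarrow> (\<forall>z\<in>K. (\<lambda>\<omega>. f \<omega> z) \<in> borel_measurable M)"

text \<open>
  The rational function \<open>p / q\<close> has no pole on \<open>K\<close> iff it can be written so that \<open>q\<close> has no zero
  on \<open>K\<close> (lowest terms, for instance). Asking for such a representation, and not only for the
  absence of poles of the quotient, avoids the value \<open>x / 0 = 0\<close> at common zeros of \<open>p\<close> and \<open>q\<close>.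
\<close>

definition rational_pole_free_on :: "complex set \<Rightarrow> (complex \<Rightarrow> complex) \<Rightarrow> bool" where
  "rational_pole_free_on K h \<longleftrightarrow>
     (\<exists>p q :: complex poly. q \<noteq> 0 \<and> (\<forall>z\<in>K. poly q z \<noteq> 0) \<and> (\<forall>z\<in>K. h z = poly p z / poly q z))"

definition random_rational_function ::
    "'w measure \<Rightarrow> complex set \<Rightarrow> ('w \<Rightarrow> complex \<Rightarrow> complex) \<Rightarrow> bool" where
  "random_rational_function M K r \<longleftrightarrow>
     random_function M K r \<and> (\<forall>\<omega>\<in>space M. rational_pole_free_on K (r \<omega>))"

definition R_unif :: "'w measure \<Rightarrow> complex set \<Rightarrow> ('w \<Rightarrow> complex \<Rightarrow> complex) set" where
  "R_unif M K = {f. random_function M K f \<and>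
     (\<forall>\<omega>\<in>space M. continuous_on K (f \<omega>) \<and> f \<omega> holomorphic_on interior K) \<and>
     (\<forall>\<epsilon>::real. \<epsilon> > 0 \<longrightarrow>
        (\<exists>r. random_rational_function M K r \<and>
           (\<forall>\<omega>\<in>space M. \<forall>z\<in>K. cmod (r \<omega> z - f \<omega> z) < \<epsilon>)))}"

end

theory Submission
  imports Defs "HOL-Complex_Analysis.Complex_Analysis"
begin

text \<open>
  Runge's theorem makes each \<open>f \<omega>\<close> a uniform limit of sums of simple poles off \<open>K\<close>: the Cauchy
  formula over all grid squares meeting \<open>K\<close> leaves, after cancellation, integrals over edges that
  miss \<open>K\<close>, and these are limits of Riemann sums. Poles and residues may be taken in countable
  dense sets, so one fixed sequence of rational functions approximates every \<open>f \<omega>\<close>. Choosing the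
  first member of the sequence that is close enough to \<open>f \<omega>\<close> on a countable dense subset of \<open>K\<close>
  is measurable in \<open>\<omega>\<close>.
\<close>

section \<open>Sums of simple poles\<close>

text \<open>A list of coefficients and poles makes concatenation add the sums, and the lists over a
  countable set are again countable. The kernel \<open>1 / (w - z)\<close> is that of the Cauchy
  formula, so a pair \<open>(c, w)\<close> contributes the residue \<open>-c\<close>.\<close>

definition pole_sum :: "(complex \<times> complex) list \<Rightarrow> complex \<Rightarrow> complex" where
  "pole_sum xs z = (\<Sum>(c, w)\<leftarrow>xs. c / (w - z))"

lemma pole_sum_simps [simp]:
  "pole_sum [] z = 0"
  "pole_sum ((c, w) # xs) z = c / (w - z) + pole_sum xs z"
  "pole_sum (xs @ ys) z = pole_sum xs z + pole_sum ys z"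
  by (simp_all add: pole_sum_def)

lemma pole_sum_scale: "pole_sum (map (\<lambda>(c, w). (k * c, w)) xs) z = k * pole_sum xs z"
  by (induction xs) (auto simp: algebra_simps)

lemma rational_pole_free_on_pole_sum:
  assumes "snd ` set xs \<inter> K = {}"
  shows "rational_pole_free_on K (pole_sum xs)"
  using assms
proof (induction xs)
  case Nil
  show ?case
    unfolding rational_pole_free_on_def by (rule exI[of _ 0], rule exI[of _ 1]) simp
next
  case (Cons x xs)
  obtain c w where x: "x = (c, w)"
    by (cases x)
  have w: "w \<notin> K"
    using Cons.prems x by auto
  obtain p q where pq: "q \<noteq> 0" "\<And>z. z \<in> K \<Longrightarrow> poly q z \<noteq> 0"
      "\<And>z. z \<in> K \<Longrightarrow> pole_sum xs z = poly p z / poly q z"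
    using Cons unfolding rational_pole_free_on_def by auto
  \<comment> \<open>\<open>[:w, -1:]\<close> is the polynomial w - z, the new factor of the common
    denominator.\<close>
  have "pole_sum (x # xs) z = poly ([:c:] * q + [:w, -1:] * p) z / poly ([:w, -1:] * q) z"
    if "z \<in> K" for z
  proof -
    have "w - z \<noteq> 0"
      using that w by auto
    then show ?thesis
      using pq(2,3)[OF that] x by (simp add: field_simps)
  qed
  moreover have "poly ([:w, -1:] * q) z \<noteq> 0" if "z \<in> K" for z
    using pq(2)[OF that] that w by auto
  moreover have "[:w, -1:] * q \<noteq> 0"
    using pq(1) by (simp del: mult_pCons_left)
  ultimately show ?case
    unfolding rational_pole_free_on_def by blast
qed

lemma continuous_on_pole_sum:
  assumes "snd ` set xs \<inter> K = {}"
  shows "continuous_on K (pole_sum xs)"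
  using assms
proof (induction xs)
  case Nil
  show ?case
    by (simp add: pole_sum_def)
next
  case (Cons x xs)
  then have "continuous_on K (\<lambda>z. fst x / (snd x - z) + pole_sum xs z)"
    by (intro continuous_intros) auto
  moreover have "pole_sum (x # xs) = (\<lambda>z. fst x / (snd x - z) + pole_sum xs z)"
    by (cases x) auto
  ultimately show ?case
    by simp
qed

section \<open>Uniform approximation by pole sums\<close>

definition pole_approximable :: "complex set \<Rightarrow> (complex \<Rightarrow> complex) \<Rightarrow> bool" where
  "pole_approximable K h \<longleftrightarrow>
     (\<forall>\<epsilon>>0. \<exists>xs. snd ` set xs \<inter> K = {} \<and> (\<forall>z\<in>K. cmod (h z - pole_sum xs z) < \<epsilon>))"

lemma pole_approximable_cong:
  assumes "pole_approximable K g" "\<And>z. z \<in> K \<Longrightarrow> h z = g z"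
  shows "pole_approximable K h"
  using assms unfolding pole_approximable_def by simp

lemma pole_approximable_pole:
  assumes "w \<notin> K"
  shows "pole_approximable K (\<lambda>z. c / (w - z))"
  unfolding pole_approximable_def
proof (intro allI impI)
  fix \<epsilon> :: real assume "\<epsilon> > 0"
  then show "\<exists>xs. snd ` set xs \<inter> K = {} \<and> (\<forall>z\<in>K. cmod (c / (w - z) - pole_sum xs z) < \<epsilon>)"
    using assms by (intro exI[of _ "[(c, w)]"]) simp
qed

lemma pole_approximable_zero: "pole_approximable K (\<lambda>z. 0)"
  unfolding pole_approximable_def by (auto intro!: exI[of _ "[]"])

lemma pole_approximable_add:
  assumes "pole_approximable K g" "pole_approximable K h"
  shows "pole_approximable K (\<lambda>z. g z + h z)"
  unfolding pole_approximable_def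
proof (intro allI impI)
  fix \<epsilon> :: real assume "\<epsilon> > 0"
  then have "\<epsilon> / 2 > 0"
    by simp
  then obtain xs ys where xs: "snd ` set xs \<inter> K = {}" "\<forall>z\<in>K. cmod (g z - pole_sum xs z) < \<epsilon> / 2"
    and ys: "snd ` set ys \<inter> K = {}" "\<forall>z\<in>K. cmod (h z - pole_sum ys z) < \<epsilon> / 2"
    using assms unfolding pole_approximable_def by metis
  have "cmod (g z + h z - pole_sum (xs @ ys) z) < \<epsilon>" if "z \<in> K" for z
  proof -
    have "cmod ((g z - pole_sum xs z) + (h z - pole_sum ys z)) < \<epsilon>"
      using xs(2) ys(2) that by (intro norm_triangle_half_r norm_triangle_lt) fastforce
    then show ?thesis
      by (simp add: algebra_simps)
  qed
  moreover have "snd ` set (xs @ ys) \<inter> K = {}"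
    using xs(1) ys(1) by (simp add: image_Un Int_Un_distrib2)
  ultimately show "\<exists>xs. snd ` set xs \<inter> K = {} \<and> (\<forall>z\<in>K. cmod (g z + h z - pole_sum xs z) < \<epsilon>)"
    by blast
qed

lemma pole_approximable_scale:
  assumes "pole_approximable K h"
  shows "pole_approximable K (\<lambda>z. k * h z)"
  unfolding pole_approximable_def
proof (intro allI impI)
  fix \<epsilon> :: real assume \<epsilon>: "\<epsilon> > 0"
  \<comment> \<open>The summand 1 covers \<open>k = 0\<close> and makes the final estimate
    strict.\<close>
  define \<delta> where "\<delta> = \<epsilon> / (cmod k + 1)"
  have k: "cmod k + 1 > 0"
    by (simp add: add_nonneg_pos)
  then have "\<delta> > 0"
    using \<epsilon> by (simp add: \<delta>_def)
  then obtain xs where xs: "snd ` set xs \<inter> K = {}" "\<forall>z\<in>K. cmod (h z - pole_sum xs z) < \<delta>"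
    using assms unfolding pole_approximable_def by blast
  define ys where "ys = map (\<lambda>(c, w). (k * c, w)) xs"
  have "cmod (k * h z - pole_sum ys z) < \<epsilon>" if "z \<in> K" for z
  proof -
    have "cmod (k * h z - pole_sum ys z) = cmod k * cmod (h z - pole_sum xs z)"
      unfolding ys_def pole_sum_scale by (simp add: right_diff_distrib flip: norm_mult)
    also have "\<dots> \<le> cmod k * \<delta>"
      using xs(2) that by (simp add: mult_left_mono less_imp_le)
    also have "\<dots> < (cmod k + 1) * \<delta>"
      using \<open>\<delta> > 0\<close> by simp
    also have "\<dots> = \<epsilon>"
      using k by (simp add: \<delta>_def)
    finally show ?thesis .
  qed
  moreover have "snd ` set ys \<inter> K = {}"
    using xs(1) by (auto simp: ys_def image_image case_prod_unfold)
  ultimately show "\<exists>xs. snd ` set xs \<inter> K = {} \<and> (\<forall>z\<in>K. cmod (k * h z - pole_sum xs z) < \<epsilon>)"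
    by blast
qed

lemma pole_approximable_diff:
  assumes "pole_approximable K g" "pole_approximable K h"
  shows "pole_approximable K (\<lambda>z. g z - h z)"
  using pole_approximable_add[OF assms(1) pole_approximable_scale[OF assms(2), of "-1"]] by simp

lemma pole_approximable_sum:
  assumes "\<And>x. x \<in> A \<Longrightarrow> pole_approximable K (h x)"
  shows "pole_approximable K (\<lambda>z. \<Sum>x\<in>A. h x z)"
  using assms
  by (induction A rule: infinite_finite_induct)
     (auto intro: pole_approximable_zero pole_approximable_add)

text \<open>Needed for passing from Riemann sums to integrals. Estimates of integrals deliver weak
  inequalities; the strict bound for the pole sum restores strictness.\<close>

lemma pole_approximable_limit:
  assumes "\<And>\<epsilon>. \<epsilon> > 0 \<Longrightarrow> \<exists>g. pole_approximable K g \<and> (\<forall>z\<in>K. cmod (h z - g z) \<le> \<epsilon>)"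
  shows "pole_approximable K h"
  unfolding pole_approximable_def
proof (intro allI impI)
  fix \<epsilon> :: real assume "\<epsilon> > 0"
  then have "\<epsilon> / 2 > 0"
    by simp
  then obtain g where g: "pole_approximable K g" "\<forall>z\<in>K. cmod (h z - g z) \<le> \<epsilon> / 2"
    using assms by blast
  obtain xs where xs: "snd ` set xs \<inter> K = {}" "\<forall>z\<in>K. cmod (g z - pole_sum xs z) < \<epsilon> / 2"
    using g(1) \<open>\<epsilon> / 2 > 0\<close> unfolding pole_approximable_def by blast
  have "cmod (h z - pole_sum xs z) < \<epsilon>" if "z \<in> K" for z
    using g(2) xs(2) that norm_triangle_ineq[of "h z - g z" "g z - pole_sum xs z"] by fastforce
  then show "\<exists>xs. snd ` set xs \<inter> K = {} \<and> (\<forall>z\<in>K. cmod (h z - pole_sum xs z) < \<epsilon>)"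
    using xs(1) by blast
qed

section \<open>Cauchy integrals along a segment\<close>

text \<open>The denominator never vanishes because the segment misses \<open>K\<close>. Continuity
  is joint in \<open>t\<close> and \<open>z\<close> so that compactness yields a modulus in
  \<open>t\<close> that is uniform in \<open>z\<close>.\<close>

lemma continuous_on_Cauchy_kernel:
  fixes a b :: complex
  assumes "continuous_on (closed_segment a b) f" "closed_segment a b \<inter> K = {}"
  shows "continuous_on ({0..1} \<times> K)
           (\<lambda>(t, z). f (linepath a b t) / (linepath a b t - z) * (b - a))"
proof -
  have seg: "linepath a b t \<in> closed_segment a b" if "t \<in> {0..1}" for t
    using that by (metis imageI path_image_def path_image_linepath)
  have "continuous_on ({0..1} \<times> K) (\<lambda>x. f (linepath a b (fst x)))"
    by (rule continuous_on_compose2[OF assms(1)])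
       (use seg in \<open>auto intro!: continuous_intros simp: linepath_def\<close>)
  moreover have "linepath a b t - z \<noteq> 0" if "t \<in> {0..1}" "z \<in> K" for t z
    using seg[OF that(1)] that(2) assms(2) by auto
  moreover have "continuous_on ({0..1} \<times> K) (\<lambda>x. linepath a b (fst x) - snd x)"
    unfolding linepath_def by (intro continuous_intros)
  ultimately show ?thesis
    unfolding case_prod_unfold
    by (intro continuous_on_mult continuous_on_divide continuous_on_const) auto
qed

text \<open>A Riemann sum of the integral is a pole sum whose poles are points of the segment, hence
  off \<open>K\<close>. Uniform continuity of the integrand on \<open>{0..1} \<times> K\<close>
  bounds the error for all \<open>z\<close> at once.\<close>

lemma pole_approximable_contour_integral_linepath:
  assumes "compact K" "continuous_on (closed_segment a b) f" "closed_segment a b \<inter> K = {}"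
  shows "pole_approximable K (\<lambda>z. contour_integral (linepath a b) (\<lambda>w. f w / (w - z)))"
proof (rule pole_approximable_limit)
  fix \<epsilon> :: real assume \<epsilon>: "\<epsilon> > 0"
  define \<phi> where "\<phi> = (\<lambda>t z. f (linepath a b t) / (linepath a b t - z) * (b - a))"
  have cont: "continuous_on ({0..1} \<times> K) (\<lambda>(t, z). \<phi> t z)"
    unfolding \<phi>_def by (rule continuous_on_Cauchy_kernel[OF assms(2,3)])
  have "uniformly_continuous_on ({0..1} \<times> K) (\<lambda>(t, z). \<phi> t z)"
    using cont assms(1) by (intro compact_uniformly_continuous compact_Times) auto
  then obtain d where d: "d > 0"
      "\<And>x y. x \<in> {0..1} \<times> K \<Longrightarrow> y \<in> {0..1} \<times> K \<Longrightarrow> dist y x < d \<Longrightarrow>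
         dist (case y of (t, z) \<Rightarrow> \<phi> t z) (case x of (t, z) \<Rightarrow> \<phi> t z) < \<epsilon>"
    using \<epsilon> unfolding uniformly_continuous_on_def by metis
  have unif: "cmod (\<phi> t z - \<phi> s z) \<le> \<epsilon>"
    if "t \<in> {0..1}" "s \<in> {0..1}" "z \<in> K" "\<bar>t - s\<bar> < d" for s t z
    using d(2)[of "(s, z)" "(t, z)"] that by (auto simp: dist_Pair_Pair dist_norm)
  have contz: "continuous_on {0..1} (\<lambda>t. \<phi> t z)" if "z \<in> K" for z
    using continuous_on_compose2[OF cont, of "{0..1}" "\<lambda>t. (t, z)"] that
    by (force intro!: continuous_intros)
  have int: "(\<lambda>t. \<phi> t z) integrable_on {u..v}" if "z \<in> K" "0 \<le> u" "v \<le> 1" for u v z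
    using contz[OF that(1)] that(2,3)
    by (intro integrable_continuous_real) (auto elim: continuous_on_subset)
  \<comment> \<open>The additive error bound \<open>\<epsilon> * (v - u)\<close> makes \<open>P\<close> amenable to bisection, in place of an
    explicit partition.\<close>
  define P where "P u v \<longleftrightarrow> (0 \<le> u \<and> v \<le> 1 \<longrightarrow>
      (\<exists>g. pole_approximable K g \<and>
        (\<forall>z\<in>K. cmod (integral {u..v} (\<lambda>t. \<phi> t z) - g z) \<le> \<epsilon> * (v - u))))" for u v
  have "(0::real) \<le> 1"
    by simp
  then have "P 0 1"
  proof (induction rule: Bolzano)
    case (trans u v w)
    show ?case
      unfolding P_def
    proof (intro impI)
      assume uw: "0 \<le> u \<and> w \<le> 1"
      obtain g h where g: "pole_approximable K g"
          "\<forall>z\<in>K. cmod (integral {u..v} (\<lambda>t. \<phi> t z) - g z) \<le> \<epsilon> * (v - u)"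
        and h: "pole_approximable K h"
          "\<forall>z\<in>K. cmod (integral {v..w} (\<lambda>t. \<phi> t z) - h z) \<le> \<epsilon> * (w - v)"
        using trans uw unfolding P_def by (meson order.trans)
      have "cmod (integral {u..w} (\<lambda>t. \<phi> t z) - (g z + h z)) \<le> \<epsilon> * (w - u)" if "z \<in> K" for z
      proof -
        have "integral {u..w} (\<lambda>t. \<phi> t z)
            = integral {u..v} (\<lambda>t. \<phi> t z) + integral {v..w} (\<lambda>t. \<phi> t z)"
          using trans uw int[OF that]
          by (simp add: Henstock_Kurzweil_Integration.integral_combine)
        then have "cmod (integral {u..w} (\<lambda>t. \<phi> t z) - (g z + h z))
            \<le> cmod (integral {u..v} (\<lambda>t. \<phi> t z) - g z) + cmod (integral {v..w} (\<lambda>t. \<phi> t z) - h z)"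
          by (simp add: norm_triangle_ineq add_diff_add)
        also have "\<dots> \<le> \<epsilon> * (v - u) + \<epsilon> * (w - v)"
          using g(2) h(2) that by (intro add_mono) auto
        finally show ?thesis
          by (simp add: algebra_simps)
      qed
      then show "\<exists>g. pole_approximable K g \<and>
          (\<forall>z\<in>K. cmod (integral {u..w} (\<lambda>t. \<phi> t z) - g z) \<le> \<epsilon> * (w - u))"
        using pole_approximable_add[OF g(1) h(1)] by blast
    qed
  next
    case (local x)
    have "P u v" if uv: "u \<le> x" "x \<le> v" "v - u < d" for u v
      unfolding P_def
    proof (intro impI)
      assume *: "0 \<le> u \<and> v \<le> 1"
      \<comment> \<open>The Riemann sum with the single sample point \<open>x\<close>: one simple
        pole at \<open>linepath a b x\<close>. The integrand varies by at most
        \<open>\<epsilon>\<close> on an interval shorter than \<open>d\<close>.\<close>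
      define g where "g z = of_real (v - u) * \<phi> x z" for z
      have "linepath a b x \<in> closed_segment a b"
        using local by (metis atLeastAtMost_iff imageI path_image_def path_image_linepath)
      then have "linepath a b x \<notin> K"
        using assms(3) by auto
      then have "pole_approximable K g"
        using pole_approximable_pole[of "linepath a b x" K
            "of_real (v - u) * f (linepath a b x) * (b - a)"]
        by (simp add: g_def[abs_def] \<phi>_def mult_ac)
      moreover have "cmod (integral {u..v} (\<lambda>t. \<phi> t z) - g z) \<le> \<epsilon> * (v - u)" if "z \<in> K" for z
      proof -
        have "((\<lambda>t. \<phi> t z - \<phi> x z) has_integral (integral {u..v} (\<lambda>t. \<phi> t z) - g z)) {u..v}"
          using has_integral_diff[OF integrable_integral[OF int[OF that]]
              has_integral_const_real[of "\<phi> x z" u v]] * uv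
          by (simp add: g_def scaleR_conv_of_real)
        moreover have "cmod (\<phi> t z - \<phi> x z) \<le> \<epsilon>" if "t \<in> {u..v}" for t
          using unif[of t x z] that \<open>z \<in> K\<close> local * uv by auto
        ultimately have "cmod (integral {u..v} (\<lambda>t. \<phi> t z) - g z)
            \<le> \<epsilon> * Henstock_Kurzweil_Integration.content {u..v}"
          using has_integral_bound_real[of \<epsilon> "{}" "\<lambda>t. \<phi> t z - \<phi> x z" _ u v] \<epsilon> by auto
        then show ?thesis
          using uv by simp
      qed
      ultimately show "\<exists>g. pole_approximable K g \<and>
          (\<forall>z\<in>K. cmod (integral {u..v} (\<lambda>t. \<phi> t z) - g z) \<le> \<epsilon> * (v - u))"
        by blast
    qed
    then show ?case
      using d(1) by blast
  qed
  then show "\<exists>g. pole_approximable K g \<and>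
      (\<forall>z\<in>K. cmod (contour_integral (linepath a b) (\<lambda>w. f w / (w - z)) - g z) \<le> \<epsilon>)"
    by (simp add: P_def contour_integral_integral \<phi>_def)
qed

text \<open>Cauchy integrals are even differentiable off the segment. Continuity will carry the
  Cauchy formula from open grid squares to points on their edges.\<close>

lemma isCont_contour_integral_linepath:
  assumes f: "continuous_on (closed_segment a b) f" and z: "z \<notin> closed_segment a b"
  shows "isCont (\<lambda>z. contour_integral (linepath a b) (\<lambda>w. f w / (w - z))) z"
proof -
  \<comment> \<open>The exponent 1 gives the integrand the shape that the rule for differentiating
    under the integral expects.\<close>
  have int: "((\<lambda>u. f u / (u - w) ^ 1) has_contour_integral
      contour_integral (linepath a b) (\<lambda>u. f u / (u - w))) (linepath a b)"
    if "w \<in> UNIV - path_image (linepath a b)" for w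
  proof -
    have "continuous_on (closed_segment a b) (\<lambda>u. f u / (u - w))"
      using that by (intro continuous_intros f) auto
    then show ?thesis
      by (simp add: contour_integrable_continuous_linepath has_contour_integral_integral)
  qed
  show ?thesis
    by (rule DERIV_isCont[OF Cauchy_next_derivative(2)[OF _ _ int, where S = UNIV and B = "norm (b - a)"]])
       (use f z in auto)
qed

section \<open>Contour integrals over rectangles\<close>

text \<open>Reversing the top and left edges orients parallel edges alike: bottom minus top, right
  minus left. In a grid, each of these differences compares an edge with its translate.\<close>

lemma contour_integral_rectpath:
  fixes a c :: complex
  defines "b \<equiv> Complex (Re c) (Im a)" and "d \<equiv> Complex (Re a) (Im c)"
  assumes g: "continuous_on (path_image (rectpath a c)) g"
  shows "contour_integral (rectpath a c) g =
    contour_integral (linepath a b) g - contour_integral (linepath d c) g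
    + (contour_integral (linepath b c) g - contour_integral (linepath a d) g)"
proof -
  have img: "path_image (rectpath a c) =
      closed_segment a b \<union> closed_segment b c \<union> closed_segment c d \<union> closed_segment d a"
    by (simp add: rectpath_def Let_def path_image_join b_def d_def Un_assoc)
  have "continuous_on (closed_segment a b) g" "continuous_on (closed_segment b c) g"
      "continuous_on (closed_segment c d) g" "continuous_on (closed_segment d a) g"
    using g unfolding img by (auto elim: continuous_on_subset)
  then show ?thesis
    unfolding rectpath_def Let_def b_def[symmetric] d_def[symmetric]
    using contour_integral_reverse_linepath[of c d g] contour_integral_reverse_linepath[of d a g]
    by (simp add: contour_integrable_continuous_linepath valid_path_join)
qed

text \<open>Inside, the winding number is 1 and the Cauchy formula applies; outside, the integrand
  is holomorphic on the closed rectangle and Cauchy's theorem gives 0.\<close>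

lemma Cauchy_integral_formula_rectpath:
  assumes f: "f holomorphic_on cbox a c" and ac: "Re a < Re c" "Im a < Im c"
    and z: "z \<notin> path_image (rectpath a c)"
  shows "contour_integral (rectpath a c) (\<lambda>w. f w / (w - z)) =
    (if z \<in> box a c then 2 * pi * \<i> * f z else 0)"
proof -
  have sub: "path_image (rectpath a c) \<subseteq> cbox a c"
    using ac by (intro path_image_rectpath_subset_cbox) auto
  show ?thesis
  proof (cases "z \<in> box a c")
    case True
    have "((\<lambda>w. f w / (w - z)) has_contour_integral
        (2 * pi * \<i> * winding_number (rectpath a c) z * f z)) (rectpath a c)"
      using True z sub
      by (intro Cauchy_integral_formula_convex_simple[OF convex_box(1) f]) (auto simp: interior_cbox)
    then show ?thesis
      using True by (simp add: winding_number_rectpath contour_integral_unique)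
  next
    case False
    then have "z \<notin> cbox a c"
      using z ac by (simp add: path_image_rectpath_cbox_minus_box)
    then have "(\<lambda>w. f w / (w - z)) holomorphic_on cbox a c"
      by (intro holomorphic_intros f) auto
    then have "((\<lambda>w. f w / (w - z)) has_contour_integral 0) (rectpath a c)"
      using sub by (intro Cauchy_theorem_convex_simple[where S = "cbox a c"]) (auto simp: convex_box)
    then show ?thesis
      using False by (simp add: contour_integral_unique)
  qed
qed

section \<open>Preparations for the grid\<close>

lemma sum_diff_shift:
  fixes g :: "'a \<Rightarrow> 'b::ab_group_add"
  assumes "finite S" "inj_on \<sigma> S"
  shows "(\<Sum>x\<in>S. g x - g (\<sigma> x)) = sum g (S - \<sigma> ` S) - sum g (\<sigma> ` S - S)"
proof -
  have "(\<Sum>x\<in>S. g x - g (\<sigma> x)) = sum g S - sum g (\<sigma> ` S)"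
    using assms(2) by (simp add: sum_subtractf sum.reindex)
  also have "sum g S = sum g (S \<inter> \<sigma> ` S) + sum g (S - \<sigma> ` S)"
    using assms(1) by (rule sum.Int_Diff)
  also have "sum g (\<sigma> ` S) = sum g (S \<inter> \<sigma> ` S) + sum g (\<sigma> ` S - S)"
    using assms(1) sum.Int_Diff[of "\<sigma> ` S" g S] by (simp add: Int_commute)
  finally show ?thesis
    by simp
qed

lemma rectangle_segments_subset_cbox:
  fixes a c :: complex
  assumes "Re a \<le> Re c" "Im a \<le> Im c"
  shows "closed_segment a (Complex (Re c) (Im a)) \<subseteq> cbox a c"
    "closed_segment (Complex (Re a) (Im c)) c \<subseteq> cbox a c"
    "closed_segment (Complex (Re c) (Im a)) c \<subseteq> cbox a c"
    "closed_segment a (Complex (Re a) (Im c)) \<subseteq> cbox a c"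
  using assms by (simp_all add: closed_segment_subset convex_box in_cbox_complex_iff)

text \<open>Applied to coordinates divided by the mesh: a point of an open square lies on no grid
  line and in no other open square.\<close>

lemma between_consecutive_ints:
  fixes t :: real
  assumes "of_int i < t" "t < of_int (i + 1)"
  shows "t \<noteq> of_int m" and "of_int k < t \<and> t < of_int (k + 1) \<longleftrightarrow> k = i"
proof -
  show "t \<noteq> of_int m"
    using assms by auto
  have "k = i" if "of_int k < t" "t < of_int (k + 1)"
  proof -
    have "\<lfloor>t\<rfloor> = k" "\<lfloor>t\<rfloor> = i"
      using assms that by (auto intro!: floor_unique)
    then show ?thesis by simp
  qed
  then show "of_int k < t \<and> t < of_int (k + 1) \<longleftrightarrow> k = i"
    using assms by blast
qed

section \<open>Runge's theorem by a grid of squares\<close>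

text \<open>Points of \<open>K\<close> may lie on grid lines, where integrals over cancelled edges
  are singular. Hence the formula \<open>F = 2 * pi * \<i> * f\<close> is proved first inside the
  squares of \<open>S\<close>, then on \<open>K\<close> by continuity.\<close>

theorem Runge_pole_sums:
  assumes K: "compact K" and U: "open U" "K \<subseteq> U" and f: "f holomorphic_on U"
  shows "pole_approximable K f"
proof -
  obtain e where e: "e > 0" "(\<Union>x\<in>K. cball x e) \<subseteq> U"
    using compact_subset_open_imp_cball_epsilon_subset[OF K U] by metis
  \<comment> \<open>Points of a square with side \<open>\<delta>\<close> are at most
    \<open>2 * \<delta> = e\<close> apart, so a square that meets \<open>K\<close> stays in
    \<open>U\<close>.\<close>
  define \<delta> where "\<delta> = e / 2"
  have \<delta>: "\<delta> > 0"
    using e by (simp add: \<delta>_def)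
  define p where "p = (\<lambda>(i::int, j::int). Complex (\<delta> * of_int i) (\<delta> * of_int j))"
  define right up where "right = (\<lambda>(i::int, j::int). (i + 1, j))" and "up = (\<lambda>(i::int, j::int). (i, j + 1))"
  define Q where "Q x = cbox (p x) (p (up (right x)))" for x
  define S where "S = {x. Q x \<inter> K \<noteq> {}}"
  \<comment> \<open>Squares are indexed by their lower left corners. \<open>H\<close> and
    \<open>V\<close> belong to the bottom and left edges of square \<open>x\<close>; its top and
    right edges are the bottom edge of \<open>up x\<close> and the left edge of
    \<open>right x\<close>.\<close>
  define H where "H z x = contour_integral (linepath (p x) (p (right x))) (\<lambda>w. f w / (w - z))" for z x
  define V where "V z x = contour_integral (linepath (p x) (p (up x))) (\<lambda>w. f w / (w - z))" for z x

  have inj: "inj right" "inj up"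
    by (auto simp: inj_def right_def up_def)
  have Re_Im: "Re (p (right x)) = Re (p x) + \<delta>" "Im (p (right x)) = Im (p x)"
      "Re (p (up x)) = Re (p x)" "Im (p (up x)) = Im (p x) + \<delta>" for x
    by (auto simp: p_def right_def up_def split: prod.split) (simp_all add: algebra_simps)
  have corners: "Complex (Re (p (up (right x)))) (Im (p x)) = p (right x)"
      "Complex (Re (p x)) (Im (p (up (right x)))) = p (up x)" for x
    by (simp_all add: complex_eq_iff Re_Im)
  have comm: "right (up x) = up (right x)" for x
    by (simp add: right_def up_def split: prod.split)
  have ord: "Re (p x) < Re (p (up (right x)))" "Im (p x) < Im (p (up (right x)))" for x
    using \<delta> by (simp_all add: Re_Im)
  note edges = rectangle_segments_subset_cbox[OF less_imp_le[OF ord(1)] less_imp_le[OF ord(2)],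
      unfolded corners, folded Q_def]

  have "finite S"
  proof -
    obtain B where B: "\<And>z. z \<in> K \<Longrightarrow> cmod z \<le> B"
      using K compact_imp_bounded bounded_iff by metis
    \<comment> \<open>The 1 is for the lower bound: only the far corner, with index
      \<open>i + 1\<close>, is known to be at least \<open>- (B / \<delta>)\<close>.\<close>
    define N where "N = \<lceil>B / \<delta>\<rceil> + 1"
    have "S \<subseteq> {-N..N} \<times> {-N..N}"
    proof
      fix x assume "x \<in> S"
      then obtain z where z: "z \<in> Q x" "z \<in> K"
        by (auto simp: S_def)
      obtain i j where x: "x = (i, j)"
        by (cases x)
      have "\<bar>Re z\<bar> \<le> B" "\<bar>Im z\<bar> \<le> B"
        using B[OF z(2)] abs_Re_le_cmod abs_Im_le_cmod order.trans by blast+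
      then have *: "\<delta> * of_int i \<le> B" "\<delta> * of_int j \<le> B" "- B \<le> \<delta> * of_int (i + 1)" "- B \<le> \<delta> * of_int (j + 1)"
        using z(1) by (auto simp: Q_def in_cbox_complex_iff p_def right_def up_def x)
      have "of_int i \<le> B / \<delta>" "of_int j \<le> B / \<delta>" "- (B / \<delta>) \<le> of_int (i + 1)" "- (B / \<delta>) \<le> of_int (j + 1)"
        using * \<delta> by (simp_all add: field_simps)
      then show "x \<in> {-N..N} \<times> {-N..N}"
        unfolding x N_def by (simp add: le_ceiling_iff) linarith
    qed
    then show ?thesis
      using finite_subset by blast
  qed

  have QU: "Q x \<subseteq> U" if x: "x \<in> S" for x
  proof
    fix w assume w: "w \<in> Q x"
    obtain z where z: "z \<in> Q x" "z \<in> K"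
      using x by (auto simp: S_def)
    have "\<bar>Re (w - z)\<bar> \<le> \<delta>" "\<bar>Im (w - z)\<bar> \<le> \<delta>"
      using w z(1) unfolding Q_def in_cbox_complex_iff by (auto simp: Re_Im)
    then have "cmod (w - z) \<le> e"
      using cmod_le[of "w - z"] by (simp add: \<delta>_def)
    then show "w \<in> U"
      using e(2) z(2) by (force simp: dist_norm norm_minus_commute)
  qed
  have cont: "continuous_on A f" if "A \<subseteq> U" for A
    using f that holomorphic_on_imp_continuous_on continuous_on_subset by blast

  \<comment> \<open>An edge that meets \<open>K\<close> lies in two squares of \<open>S\<close>, so its two contributions cancel.\<close>
  have Hgood: "closed_segment (p x) (p (right x)) \<subseteq> U - K"
    if "x \<in> (S - up ` S) \<union> (up ` S - S)" for x
  proof -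
    obtain y where y: "x = up y"
      by (metis up_def case_prod_conv diff_add_cancel surj_pair)
    have "closed_segment (p x) (p (right x)) \<subseteq> Q x" "closed_segment (p x) (p (right x)) \<subseteq> Q y"
      using edges[of x] edges[of y] by (auto simp: y comm)
    \<comment> \<open>Exactly one of the two adjacent squares is in \<open>S\<close>: that one keeps
      the edge in \<open>U\<close>, the other keeps it off \<open>K\<close>.\<close>
    moreover have "x \<in> S \<and> y \<notin> S \<or> x \<notin> S \<and> y \<in> S"
      using that inj(2) by (auto simp: y inj_image_mem_iff dest: injD)
    ultimately show ?thesis
      using QU unfolding S_def by blast
  qed
  have Vgood: "closed_segment (p x) (p (up x)) \<subseteq> U - K"
    if "x \<in> (S - right ` S) \<union> (right ` S - S)" for x
  proof -
    obtain y where y: "x = right y"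
      by (metis right_def case_prod_conv diff_add_cancel surj_pair)
    have "closed_segment (p x) (p (up x)) \<subseteq> Q x" "closed_segment (p x) (p (up x)) \<subseteq> Q y"
      using edges[of x] edges[of y] by (auto simp: y comm)
    moreover have "x \<in> S \<and> y \<notin> S \<or> x \<notin> S \<and> y \<in> S"
      using that inj(1) by (auto simp: y inj_image_mem_iff dest: injD)
    ultimately show ?thesis
      using QU unfolding S_def by blast
  qed

  \<comment> \<open>The boundary integral after cancellation. Only edges that miss \<open>K\<close>
    are left, so \<open>F\<close> is meaningful and continuous at every point of
    \<open>K\<close>.\<close>
  define F where "F z = (sum (H z) (S - up ` S) - sum (H z) (up ` S - S))
      - (sum (V z) (S - right ` S) - sum (V z) (right ` S - S))" for z

  \<comment> \<open>Such a \<open>u\<close> is on no grid line, so the cancelled edges can be put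
    back; of all squares in \<open>S\<close> only the one containing \<open>u\<close>
    contributes.\<close>
  have F_box: "F u = 2 * pi * \<i> * f u" if "x \<in> S" and u: "u \<in> box (p x) (p (up (right x)))" for x u
  proof -
    have off: "u \<notin> path_image (rectpath (p y) (p (up (right y))))"
      and only: "u \<in> box (p y) (p (up (right y))) \<longleftrightarrow> y = x" for y
    proof -
      obtain i j k l where xy: "x = (i, j)" "y = (k, l)"
        by (metis surj_pair)
      have "of_int i < Re u / \<delta>" "Re u / \<delta> < of_int (i + 1)" "of_int j < Im u / \<delta>" "Im u / \<delta> < of_int (j + 1)"
        using u \<delta> by (auto simp: in_box_complex_iff p_def up_def right_def xy field_simps)
      note * = between_consecutive_ints[OF this(1,2)] between_consecutive_ints[OF this(3,4)]
      have "Re u \<noteq> \<delta> * of_int m" "Im u \<noteq> \<delta> * of_int m" for m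
        using *(1,3)[of m] \<delta> by (auto simp: field_simps)
      from this[of k] this[of "k + 1"] this[of l] this[of "l + 1"]
      show "u \<notin> path_image (rectpath (p y) (p (up (right y))))"
        unfolding path_image_rectpath[OF less_imp_le[OF ord(1)] less_imp_le[OF ord(2)]]
        by (auto simp: p_def up_def right_def xy(2))
      have "u \<in> box (p y) (p (up (right y))) \<longleftrightarrow>
          (of_int k < Re u / \<delta> \<and> Re u / \<delta> < of_int (k + 1)) \<and>
          (of_int l < Im u / \<delta> \<and> Im u / \<delta> < of_int (l + 1))"
        using \<delta> by (auto simp: in_box_complex_iff p_def up_def right_def xy(2) field_simps)
      then show "u \<in> box (p y) (p (up (right y))) \<longleftrightarrow> y = x"
        using *(2,4) by (auto simp: xy)
    qed
    have square: "(H u y - H u (up y)) - (V u y - V u (right y)) = (if y = x then 2 * pi * \<i> * f u else 0)"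
      if "y \<in> S" for y
    proof -
      have img: "path_image (rectpath (p y) (p (up (right y)))) \<subseteq> Q y"
        unfolding Q_def using ord by (intro path_image_rectpath_subset_cbox) (auto simp: less_imp_le)
      have "continuous_on (path_image (rectpath (p y) (p (up (right y))))) (\<lambda>w. f w / (w - u))"
        using off[of y] img QU[OF that] by (intro continuous_intros cont) auto
      from contour_integral_rectpath[OF this]
      have "contour_integral (rectpath (p y) (p (up (right y)))) (\<lambda>w. f w / (w - u)) =
          (H u y - H u (up y)) - (V u y - V u (right y))"
        unfolding corners by (simp add: H_def V_def comm)
      moreover have "f holomorphic_on Q y"
        using f QU[OF that] holomorphic_on_subset by blast
      ultimately show ?thesis
        using Cauchy_integral_formula_rectpath[OF _ ord off] only unfolding Q_def by simp
    qed
    have "F u = (\<Sum>y\<in>S. H u y - H u (up y)) - (\<Sum>y\<in>S. V u y - V u (right y))"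
      unfolding F_def using \<open>finite S\<close> inj by (simp add: sum_diff_shift inj_on_subset)
    also have "\<dots> = (\<Sum>y\<in>S. if y = x then 2 * pi * \<i> * f u else 0)"
      using square by (simp flip: sum_subtractf)
    finally show ?thesis
      using \<open>finite S\<close> \<open>x \<in> S\<close> by simp
  qed

  have F_eq: "F z = 2 * pi * \<i> * f z" if z: "z \<in> K" for z
  proof -
    \<comment> \<open>Rounding down finds a closed square containing \<open>z\<close>; it is in
      \<open>S\<close> because \<open>z\<close> is in \<open>K\<close>.\<close>
    define i j where "i = \<lfloor>Re z / \<delta>\<rfloor>" and "j = \<lfloor>Im z / \<delta>\<rfloor>"
    define x where "x = (i, j)"
    have "of_int i \<le> Re z / \<delta>" "Re z / \<delta> \<le> of_int (i + 1)"
        "of_int j \<le> Im z / \<delta>" "Im z / \<delta> \<le> of_int (j + 1)"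
      unfolding i_def j_def by linarith+
    then have zQ: "z \<in> Q x"
      using \<delta> by (simp add: Q_def in_cbox_complex_iff p_def up_def right_def x_def field_simps)
    then have "x \<in> S"
      using z by (auto simp: S_def)
    have "box (p x) (p (up (right x))) \<noteq> {}"
      using ord[of x] by (auto simp: box_ne_empty Basis_complex_def)
    \<comment> \<open>If \<open>z\<close> is on an edge, \<open>F_box\<close> does not apply to it;
      it is approached from inside the square, by points that may be outside
      \<open>K\<close>.\<close>
    then have "z \<in> closure (box (p x) (p (up (right x))))"
      using zQ by (simp add: closure_box Q_def)
    then obtain s where s: "\<And>n. s n \<in> box (p x) (p (up (right x)))" "s \<longlonglongrightarrow> z"
      unfolding closure_sequential by blast
    have "isCont (\<lambda>z. H z y) z" if "y \<in> (S - up ` S) \<union> (up ` S - S)" for y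
      unfolding H_def using Hgood[OF that] z by (intro isCont_contour_integral_linepath cont) auto
    moreover have "isCont (\<lambda>z. V z y) z" if "y \<in> (S - right ` S) \<union> (right ` S - S)" for y
      unfolding V_def using Vgood[OF that] z by (intro isCont_contour_integral_linepath cont) auto
    ultimately have "isCont F z"
      unfolding F_def[abs_def] by (intro continuous_intros) auto
    then have "(\<lambda>n. F (s n)) \<longlonglongrightarrow> F z"
      using s(2) isCont_tendsto_compose by blast
    moreover have "isCont f z"
      using cont[of U] U z by (auto simp: continuous_on_eq_continuous_at)
    then have "(\<lambda>n. 2 * pi * \<i> * f (s n)) \<longlonglongrightarrow> 2 * pi * \<i> * f z"
      by (intro tendsto_mult tendsto_const isCont_tendsto_compose[OF _ s(2)])
    ultimately show ?thesis
      unfolding F_box[OF \<open>x \<in> S\<close> s(1)] by (rule LIMSEQ_unique)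
  qed

  have "pole_approximable K (\<lambda>z. H z y)" if "y \<in> (S - up ` S) \<union> (up ` S - S)" for y
    unfolding H_def using Hgood[OF that] K
    by (intro pole_approximable_contour_integral_linepath cont) auto
  moreover have "pole_approximable K (\<lambda>z. V z y)" if "y \<in> (S - right ` S) \<union> (right ` S - S)" for y
    unfolding V_def using Vgood[OF that] K
    by (intro pole_approximable_contour_integral_linepath cont) auto
  ultimately have "pole_approximable K F"
    unfolding F_def[abs_def] by (intro pole_approximable_diff pole_approximable_sum) auto
  then have "pole_approximable K (\<lambda>z. 1 / (2 * pi * \<i>) * F z)"
    by (rule pole_approximable_scale)
  then show ?thesis
    by (rule pole_approximable_cong) (simp add: F_eq)
qed

section \<open>Reduction to a countable family\<close>

text \<open>A term \<open>c / (w - z)\<close> depends continuously on \<open>c\<close> and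
  \<open>w\<close>, uniformly for \<open>z\<close> in the compact \<open>K\<close>. The terms are
  moved into the dense sets one by one, each step keeping half of the error for the rest of the
  list.\<close>

lemma pole_sum_dense:
  assumes K: "compact K"
    and D: "UNIV \<subseteq> closure D" and E: "- K \<subseteq> closure E" "E \<inter> K = {}"
    and xs: "snd ` set xs \<inter> K = {}" and "\<epsilon> > 0"
  shows "\<exists>ys\<in>lists (D \<times> E). \<forall>z\<in>K. cmod (pole_sum xs z - pole_sum ys z) < \<epsilon>"
  using xs \<open>\<epsilon> > 0\<close>
proof (induction xs arbitrary: \<epsilon>)
  case Nil
  then show ?case
    by (auto intro!: bexI[of _ "[]"])
next
  case (Cons x xs)
  obtain c w where x: "x = (c, w)"
    by (cases x)
  have w: "w \<in> - K"
    using Cons.prems x by auto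
  have "\<epsilon> / 2 > 0"
    using Cons.prems by simp
  moreover have "snd ` set xs \<inter> K = {}"
    using Cons.prems(1) by auto
  ultimately obtain ys where ys: "ys \<in> lists (D \<times> E)"
      "\<forall>z\<in>K. cmod (pole_sum xs z - pole_sum ys z) < \<epsilon> / 2"
    using Cons.IH by blast
  have "open (- K)"
    using K by (simp add: compact_imp_closed open_Compl)
  then obtain \<rho> where \<rho>: "\<rho> > 0" "cball w \<rho> \<subseteq> - K"
    using w open_contains_cball by metis
  \<comment> \<open>A compact neighbourhood of \<open>(c, w)\<close> whose poles stay off
    \<open>K\<close>; the radius 1 is arbitrary.\<close>
  define L where "L = cball c 1 \<times> cball w \<rho>"
  have "continuous_on (L \<times> K) (\<lambda>x. fst (fst x) / (snd (fst x) - snd x))"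
    using \<rho>(2) by (intro continuous_intros) (auto simp: L_def)
  moreover have "compact (L \<times> K)"
    unfolding L_def using K by (intro compact_Times) auto
  ultimately have "uniformly_continuous_on (L \<times> K) (\<lambda>x. fst (fst x) / (snd (fst x) - snd x))"
    by (rule compact_uniformly_continuous)
  then obtain d where d: "d > 0" and dd:
      "\<And>x y. x \<in> L \<times> K \<Longrightarrow> y \<in> L \<times> K \<Longrightarrow> dist y x < d \<Longrightarrow>
         dist (fst (fst y) / (snd (fst y) - snd y)) (fst (fst x) / (snd (fst x) - snd x)) < \<epsilon> / 2"
    using \<open>\<epsilon> / 2 > 0\<close> unfolding uniformly_continuous_on_def by metis
  \<comment> \<open>\<open>d / 2\<close> because the two displacements add up; 1 and
    \<open>\<rho>\<close> keep the new pair in \<open>L\<close>.\<close>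
  define \<eta> where "\<eta> = min (d / 2) (min 1 \<rho>)"
  have \<eta>: "\<eta> > 0" "\<eta> \<le> d / 2" "\<eta> \<le> 1" "\<eta> \<le> \<rho>"
    using d \<rho>(1) by (auto simp: \<eta>_def)
  obtain c' where c': "c' \<in> D" "dist c' c < \<eta>"
    using D \<eta>(1) by (metis UNIV_I closure_approachable subsetD)
  obtain w' where w': "w' \<in> E" "dist w' w < \<eta>"
    using E(1) w \<eta>(1) by (metis closure_approachable subsetD)
  have "cmod (pole_sum (x # xs) z - pole_sum ((c', w') # ys) z) < \<epsilon>" if "z \<in> K" for z
  proof -
    have "dist (c', w') (c, w) < d"
    proof -
      have "dist (c', w') (c, w) \<le> dist c' c + dist w' w"
        by (simp add: dist_Pair_Pair sqrt_sum_squares_le_sum)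
      then show ?thesis
        using c'(2) w'(2) \<eta>(2) by linarith
    qed
    then have "dist ((c', w'), z) ((c, w), z) < d"
      by (simp add: dist_Pair_Pair[of "(c', w')"])
    then have "dist (c' / (w' - z)) (c / (w - z)) < \<epsilon> / 2"
      using dd[of "((c, w), z)" "((c', w'), z)"] c'(2) w'(2) \<eta> \<rho>(1) that
      by (auto simp: L_def dist_commute)
    then have "cmod (c / (w - z) - c' / (w' - z)) < \<epsilon> / 2"
      by (simp add: dist_norm norm_minus_commute)
    then have "cmod ((c / (w - z) - c' / (w' - z)) + (pole_sum xs z - pole_sum ys z)) < \<epsilon>"
      using ys(2) that norm_triangle_ineq[of "c / (w - z) - c' / (w' - z)" "pole_sum xs z - pole_sum ys z"]
      by fastforce
    then show ?thesis
      by (simp add: x algebra_simps)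
  qed
  moreover have "(c', w') # ys \<in> lists (D \<times> E)"
    using ys(1) c'(1) w'(1) by auto
  ultimately show ?case
    by blast
qed

section \<open>Measurable choice of the approximant\<close>

text \<open>Testing closeness on a countable set makes each event \<open>P n\<close> measurable,
  hence also the least index. Continuity of \<open>f \<omega>\<close> and of the pole sums extends
  the estimate from that set to \<open>K\<close>.\<close>

lemma random_rational_approximation:
  fixes M :: "'w measure" and K :: "complex set" and f :: "'w \<Rightarrow> complex \<Rightarrow> complex"
  assumes K: "compact K" and f: "random_function M K f"
    and cont: "\<And>\<omega>. \<omega> \<in> space M \<Longrightarrow> continuous_on K (f \<omega>)"
    and appr: "\<And>\<omega>. \<omega> \<in> space M \<Longrightarrow> pole_approximable K (f \<omega>)"
    and \<epsilon>: "\<epsilon> > 0"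
  shows "\<exists>r. random_rational_function M K r \<and> (\<forall>\<omega>\<in>space M. \<forall>z\<in>K. cmod (r \<omega> z - f \<omega> z) < \<epsilon>)"
proof -
  obtain D :: "complex set" where D: "countable D" "UNIV \<subseteq> closure D"
    using separable by metis
  obtain E where E: "countable E" "E \<subseteq> - K" "- K \<subseteq> closure E"
    using separable by metis
  obtain T where T: "countable T" "T \<subseteq> K" "K \<subseteq> closure T"
    using separable by metis
  define Q where "Q = from_nat_into (lists (D \<times> E))"
  \<comment> \<open>The empty list is a member, so \<open>from_nat_into\<close> does enumerate the
    family.\<close>
  have ne: "lists (D \<times> E) \<noteq> {}"
    by blast
  have count: "countable (lists (D \<times> E))"
    using D(1) E(1) by (intro countable_lists countable_SIGMA)
  have QK: "snd ` set (Q n) \<inter> K = {}" for n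
    using from_nat_into[OF ne, of n] E(2) by (fastforce simp: Q_def)
  \<comment> \<open>Weak inequalities survive the passage to the closure of \<open>T\<close>; the
    bound \<open>\<epsilon> / 2\<close> leaves room for strictness at the end.\<close>
  define P where "P n \<omega> \<longleftrightarrow> (\<forall>z\<in>T. cmod (pole_sum (Q n) z - f \<omega> z) \<le> \<epsilon> / 2)" for n \<omega>
  define r where "r \<omega> = pole_sum (Q (LEAST n. P n \<omega>))" for \<omega>
  have ex: "\<exists>n. P n \<omega>" if \<omega>: "\<omega> \<in> space M" for \<omega>
  proof -
    \<comment> \<open>Two errors below \<open>\<epsilon> / 4\<close>, from Runge approximation and
      from moving into the countable family, add up to \<open>\<epsilon> / 2\<close>.\<close>
    have "\<epsilon> / 4 > 0"
      using \<epsilon> by simp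
    then obtain xs where xs: "snd ` set xs \<inter> K = {}" "\<forall>z\<in>K. cmod (f \<omega> z - pole_sum xs z) < \<epsilon> / 4"
      using appr[OF \<omega>] unfolding pole_approximable_def by blast
    obtain ys where ys: "ys \<in> lists (D \<times> E)" "\<forall>z\<in>K. cmod (pole_sum xs z - pole_sum ys z) < \<epsilon> / 4"
      using pole_sum_dense[OF K D(2) E(3) _ xs(1) \<open>\<epsilon> / 4 > 0\<close>] E(2) by blast
    obtain n where n: "Q n = ys"
      unfolding Q_def using from_nat_into_surj[OF count ys(1)] by blast
    have "cmod (pole_sum ys z - f \<omega> z) \<le> \<epsilon> / 2" if "z \<in> T" for z
    proof -
      have "z \<in> K"
        using that T(2) by blast
      then show ?thesis
        using xs(2) ys(2) norm_triangle_ineq[of "f \<omega> z - pole_sum xs z" "pole_sum xs z - pole_sum ys z"]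
        by (fastforce simp: norm_minus_commute)
    qed
    then show ?thesis
      using n unfolding P_def by blast
  qed
  have close: "cmod (r \<omega> z - f \<omega> z) \<le> \<epsilon> / 2" if \<omega>: "\<omega> \<in> space M" and "z \<in> K" for \<omega> z
  proof -
    have "P (LEAST n. P n \<omega>) \<omega>"
      using ex[OF \<omega>] by (rule LeastI_ex)
    then have "\<And>z. z \<in> T \<Longrightarrow> cmod (r \<omega> z - f \<omega> z) \<le> \<epsilon> / 2"
      unfolding P_def r_def by blast
    moreover have "closure T = K"
      using T K by (simp add: closure_minimal compact_imp_closed subset_antisym)
    moreover have "continuous_on K (\<lambda>z. cmod (r \<omega> z - f \<omega> z))"
      unfolding r_def by (intro continuous_intros continuous_on_pole_sum QK cont \<omega>)
    ultimately show ?thesis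
      using continuous_le_on_closure[of T "\<lambda>z. cmod (r \<omega> z - f \<omega> z)" z "\<epsilon> / 2"] \<open>z \<in> K\<close> by simp
  qed
  have measP: "Measurable.pred M (P n)" for n
  proof -
    have "Measurable.pred M (\<lambda>\<omega>. cmod (pole_sum (Q n) z - f \<omega> z) \<le> \<epsilon> / 2)" if "z \<in> T" for z
    proof -
      have [measurable]: "(\<lambda>\<omega>. f \<omega> z) \<in> borel_measurable M"
        using f that T(2) unfolding random_function_def by blast
      show ?thesis
        by measurable
    qed
    then show ?thesis
      unfolding P_def using T(1) by (intro measurable_pred_countable(1))
  qed
  have "random_function M K r"
    unfolding random_function_def
  proof
    fix z assume "z \<in> K"
    \<comment> \<open>The index is measurable into a discrete space, on which every function is
      measurable.\<close>
    have "(\<lambda>\<omega>. LEAST n. P n \<omega>) \<in> measurable M (count_space UNIV)"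
      using measP by (intro measurable_Least) simp
    then show "(\<lambda>\<omega>. r \<omega> z) \<in> borel_measurable M"
      unfolding r_def by (rule measurable_compose[where g = "\<lambda>n. pole_sum (Q n) z"]) simp
  qed
  then have "random_rational_function M K r"
    unfolding random_rational_function_def r_def
    using rational_pole_free_on_pole_sum QK by blast
  moreover have "cmod (r \<omega> z - f \<omega> z) < \<epsilon>" if "\<omega> \<in> space M" "z \<in> K" for \<omega> z
    using close[OF that] \<epsilon> by linarith
  ultimately show ?thesis
    by blast
qed

section \<open>From holomorphic extensions to \<open>R_unif\<close>\<close>

theorem theorem5p7:
  fixes M :: "'w measure" and K :: "complex set" and f :: "'w \<Rightarrow> complex \<Rightarrow> complex"
  assumes "compact K" and "K \<noteq> {}"
    and "random_function M K f"
    and "\<And>\<omega>. \<omega> \<in> space M \<Longrightarrow>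
      \<exists>U g. open U \<and> K \<subseteq> U \<and> g holomorphic_on U \<and> (\<forall>z\<in>K. g z = f \<omega> z)"
  shows "f \<in> R_unif M K"
proof -
  \<comment> \<open>\<open>U\<close> and \<open>g\<close> are chosen for one \<open>\<omega>\<close>
    at a time and enter only through these properties of \<open>f \<omega>\<close>; measurability
    comes from \<open>f\<close> itself.\<close>
  have *: "continuous_on K (f \<omega>)" "f \<omega> holomorphic_on interior K" "pole_approximable K (f \<omega>)"
    if "\<omega> \<in> space M" for \<omega>
  proof -
    obtain U g where U: "open U" "K \<subseteq> U" and g: "g holomorphic_on U" "\<And>z. z \<in> K \<Longrightarrow> g z = f \<omega> z"
      using assms(4)[OF \<open>\<omega> \<in> space M\<close>] by blast
    have gK: "g holomorphic_on K"
      using g(1) U(2) by (rule holomorphic_on_subset)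
    show "continuous_on K (f \<omega>)"
      using holomorphic_on_imp_continuous_on[OF gK] g(2) by (simp cong: continuous_on_cong)
    show "f \<omega> holomorphic_on interior K"
      using holomorphic_on_subset[OF gK interior_subset]
      by (rule holomorphic_transform) (use g(2) interior_subset in blast)
    show "pole_approximable K (f \<omega>)"
      using Runge_pole_sums[OF assms(1) U g(1)]
      by (rule pole_approximable_cong) (simp add: g(2))
  qed
  then show ?thesis
    unfolding R_unif_def
    using assms(3) random_rational_approximation[OF assms(1,3) *(1) *(3)] by simp
qed

end
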